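(* Let $d$ be an even nonnegative integer and let $h(t) = h_0 + h_1 t + \cdots + h_d t^d$ be a reciprocal polynomial, i.e. $h_k = h_{d-k}$ for $0 \le k \le d$. Let $\gamma(u) = \sum_{i=0}^{d/2} \gamma_i u^i$ be its gamma polynomial, where $\gamma_0, \ldots, \gamma_{d/2}$ are the unique numbers with $h(t) = \sum_{i=0}^{d/2} \gamma_i t^i (1+t)^{d-2i}$. Define \[ g(u) := h_{d/2} + 2 \sum_{j=1}^{d/2} h_{d/2 - j}\, T_j\!\left( \frac{u}{2} \right), \] where $T_j$ is the $j$-th Chebyshev polynomial of the first kind ($T_j(\cos\alpha) = \cos(j\alpha)$). Then \[ \gamma(u) = u^{d/2}\, g\!\left( \frac{1}{u} - 2 \right). \] Equivalently, $u^{d/2}\gamma(1/u) = g(u-2)$, and $(u+2)^{d/2}\gamma\!\left(\frac{1}{u+2}\right) = g(u)$.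
   Context: Chebyshev polynomials of the first kind $T_j(x)$ are defined by $T_j(\cos\alpha)=\cos(j\alpha)$; equivalently $T_0=1$, $T_1=x$, $T_{n}=2xT_{n-1}-T_{n-2}$. The gamma vector of a reciprocal polynomial $h$ of even degree $d$ is the tuple $(\gamma_0,\dots,\gamma_{d/2})$ of unique coefficients with $h(t)=\sum_{i=0}^{d/2}\gamma_i t^i(1+t)^{d-2i}$, and the gamma polynomial is $\gamma(u)=\sum_i \gamma_i u^i$. *)

theory Defs
  imports "HOL-Computational_Algebra.Polynomial"
begin

fun cheb_T :: "nat \<Rightarrow> 'a::comm_ring_1 poly" where
  "cheb_T 0 = 1"
| "cheb_T (Suc 0) = [:0, 1:]"
| "cheb_T (Suc (Suc n)) = 2 * [:0, 1:] * cheb_T (Suc n) - cheb_T n"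

lemma poly_cheb_T_cos: "poly (cheb_T n) (cos x) = cos (real n * x)" for x :: real
proof (induction n rule: cheb_T.induct)
  case (3 n)
  have "cos (real n * x) = cos (real (Suc n) * x - x)"
       "cos (real (Suc (Suc n)) * x) = cos (real (Suc n) * x + x)"
    by (simp_all add: algebra_simps)
  with 3 show ?case by (simp add: cos_add cos_diff del: of_nat_Suc)
qed auto

text \<open>Here \<open>d\<close> is the formal degree: the leading coefficient \<open>coeff h d\<close> may vanish.\<close>

definition reciprocal_poly :: "nat \<Rightarrow> 'a::comm_ring_1 poly \<Rightarrow> bool" where
  "reciprocal_poly d h \<longleftrightarrow> degree h \<le> d \<and> (\<forall>k\<le>d. coeff h k = coeff h (d - k))"

text \<open>The tuple $(\gamma_0, \dots, \gamma_{d/2})$ is encoded as a sequence vanishing beyond index $d/2$.\<close>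

definition is_gamma_vector :: "nat \<Rightarrow> 'a::comm_ring_1 poly \<Rightarrow> (nat \<Rightarrow> 'a) \<Rightarrow> bool" where
  "is_gamma_vector d h \<gamma> \<longleftrightarrow>
     h = (\<Sum>i\<le>d div 2. smult (\<gamma> i) ([:0, 1:] ^ i * [:1, 1:] ^ (d - 2 * i))) \<and>
     (\<forall>i>d div 2. \<gamma> i = 0)"

definition gamma_vector :: "nat \<Rightarrow> 'a::comm_ring_1 poly \<Rightarrow> nat \<Rightarrow> 'a" where
  "gamma_vector d h = (THE \<gamma>. is_gamma_vector d h \<gamma>)"

definition gamma_poly :: "nat \<Rightarrow> 'a::comm_ring_1 poly \<Rightarrow> 'a poly" where
  "gamma_poly d h = (\<Sum>i\<le>d div 2. monom (gamma_vector d h i) i)"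

definition cheb_g :: "nat \<Rightarrow> 'a::field_char_0 poly \<Rightarrow> 'a \<Rightarrow> 'a" where
  "cheb_g d h u = coeff h (d div 2) +
     2 * (\<Sum>j=1..d div 2. coeff h (d div 2 - j) * poly (cheb_T j) (u / 2))"

lemma gamma_sum_Suc:
  "(\<Sum>i\<le>Suc m. smult (\<gamma> i) ([:0, 1:] ^ i * [:1, 1:] ^ (2 * Suc m - 2 * i))) =
   smult (\<gamma> 0) ([:1, 1:] ^ (2 * Suc m)) +
   pCons 0 (\<Sum>i\<le>m. smult (\<gamma> (Suc i)) ([:0, 1:] ^ i * [:1, 1:] ^ (2 * m - 2 * i)))"
  for \<gamma> :: "nat \<Rightarrow> 'a::comm_ring_1"
proof -
  have *: "pCons 0 p = [:0, 1:] * p" for p :: "'a poly" by simp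
  have "2 * Suc m - 2 * Suc i = 2 * m - 2 * i" for i by simp
  then show ?thesis
    unfolding sum.atMost_Suc_shift *[of "sum _ _"] sum_distrib_left
    by (simp only: mult_smult_right mult.assoc power_Suc power_0 mult_1_left mult_0_right diff_zero)
qed

lemma coeff_one_plus_power: "coeff ([:1, 1:] ^ n) k = of_nat (n choose k)"
  for k :: nat
proof (induction n arbitrary: k)
  case (Suc n)
  show ?case by (cases k) (simp_all add: Suc add.commute)
qed (auto simp: binomial_eq_0)

lemma gamma_sum_inj:
  fixes \<gamma> \<delta> :: "nat \<Rightarrow> 'a::comm_ring_1"
  assumes "(\<Sum>i\<le>m. smult (\<gamma> i) ([:0, 1:] ^ i * [:1, 1:] ^ (2 * m - 2 * i))) =
           (\<Sum>i\<le>m. smult (\<delta> i) ([:0, 1:] ^ i * [:1, 1:] ^ (2 * m - 2 * i)))"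
    and "i \<le> m"
  shows "\<gamma> i = \<delta> i"
  using assms
proof (induction m arbitrary: \<gamma> \<delta> i)
  case (Suc m)
  note eq = Suc.prems(1)[unfolded gamma_sum_Suc]
  have 0: "\<gamma> 0 = \<delta> 0"
    using arg_cong[OF eq, of "\<lambda>p. coeff p 0"] by (simp add: coeff_one_plus_power del: power_Suc mult_Suc_right)
  show ?case
  proof (cases i)
    case (Suc j)
    have "(\<Sum>i\<le>m. smult (\<gamma> (Suc i)) ([:0, 1:] ^ i * [:1, 1:] ^ (2 * m - 2 * i))) =
          (\<Sum>i\<le>m. smult (\<delta> (Suc i)) ([:0, 1:] ^ i * [:1, 1:] ^ (2 * m - 2 * i)))"
      using eq unfolding 0 add_left_cancel pCons_eq_iff by simp
    from Suc.IH[OF this, of j] Suc \<open>i \<le> Suc m\<close> show ?thesis by simp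
  qed (simp add: 0)
qed auto

lemma gamma_sum_ex:
  fixes h :: "'a::comm_ring_1 poly"
  assumes "reciprocal_poly (2 * m) h"
  shows "\<exists>\<gamma>. h = (\<Sum>i\<le>m. smult (\<gamma> i) ([:0, 1:] ^ i * [:1, 1:] ^ (2 * m - 2 * i)))"
  using assms
proof (induction m arbitrary: h)
  case 0
  then have "h = [:coeff h 0:]"
    by (simp add: reciprocal_poly_def degree_0_id)
  then show ?case by (intro exI[of _ "\<lambda>_. coeff h 0"]) simp
next
  case (Suc m)
  define p where "p = h - smult (coeff h 0) ([:1, 1:] ^ (2 * Suc m))"
  have cp: "coeff p k = coeff h k - coeff h 0 * of_nat (2 * Suc m choose k)" for k
    by (simp only: p_def coeff_diff coeff_smult coeff_one_plus_power)
  have hsym: "coeff h k = coeff h (2 * Suc m - k)" if "k \<le> 2 * Suc m" for k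
    using Suc.prems that unfolding reciprocal_poly_def by blast
  have symp: "coeff p k = coeff p (2 * Suc m - k)" if "k \<le> 2 * Suc m" for k
    unfolding cp hsym[OF that, symmetric] binomial_symmetric[OF that, symmetric] ..
  have big: "coeff p k = 0" if "k > 2 * Suc m" for k
  proof -
    have "degree h < k" using Suc.prems that unfolding reciprocal_poly_def by linarith
    from coeff_eq_0[OF this] show ?thesis
      by (simp only: cp binomial_eq_0[OF that] of_nat_0 mult_zero_right diff_self)
  qed
  have p0: "coeff p 0 = 0" by (simp only: cp binomial_n_0 of_nat_1 mult_1_right diff_self)
  obtain q where q: "p = pCons 0 q"
    using p0 by (cases p) auto
  have cq: "coeff q k = coeff p (Suc k)" for k by (simp add: q)
  have "reciprocal_poly (2 * m) q"
    unfolding reciprocal_poly_def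
  proof (intro conjI allI impI degree_le)
    fix k assume k: "k > 2 * m"
    show "coeff q k = 0"
    proof (cases "k = 2 * m + 1")
      case True
      then have "2 * Suc m - Suc k = 0" "Suc k \<le> 2 * Suc m" by simp_all
      with symp[of "Suc k"] p0 show ?thesis unfolding cq by metis
    next
      case False
      with k show ?thesis unfolding cq by (intro big) presburger
    qed
  next
    fix k assume "k \<le> 2 * m"
    then have "2 * Suc m - Suc k = Suc (2 * m - k)" "Suc k \<le> 2 * Suc m" by simp_all
    with symp[of "Suc k"] show "coeff q k = coeff q (2 * m - k)"
      unfolding cq by metis
  qed
  from Suc.IH[OF this] obtain \<gamma>
    where \<gamma>: "q = (\<Sum>i\<le>m. smult (\<gamma> i) ([:0, 1:] ^ i * [:1, 1:] ^ (2 * m - 2 * i)))" ..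
  have "pCons 0 q + smult (coeff h 0) ([:1, 1:] ^ (2 * Suc m)) = h"
    unfolding q[symmetric] p_def by (rule diff_add_cancel)
  then have "(\<Sum>i\<le>Suc m. smult (case_nat (coeff h 0) \<gamma> i) ([:0, 1:] ^ i * [:1, 1:] ^ (2 * Suc m - 2 * i))) = h"
    unfolding gamma_sum_Suc nat.case \<gamma>[symmetric] by (subst add.commute)
  note eq = this
  show ?case
    by (rule exI[of _ "case_nat (coeff h 0) \<gamma>"]) (rule eq[symmetric])
qed

lemma ex1_gamma_vector:
  fixes h :: "'a::comm_ring_1 poly"
  assumes "even d" "reciprocal_poly d h"
  shows "\<exists>!\<gamma>. is_gamma_vector d h \<gamma>"
proof -
  obtain m where d: "d = 2 * m" using assms(1) by blast
  obtain \<gamma> where \<gamma>: "h = (\<Sum>i\<le>m. smult (\<gamma> i) ([:0, 1:] ^ i * [:1, 1:] ^ (2 * m - 2 * i)))"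
    using gamma_sum_ex assms(2) d by blast
  show ?thesis
  proof (rule ex1I[of _ "\<lambda>i. if i \<le> m then \<gamma> i else 0"])
    show "is_gamma_vector d h (\<lambda>i. if i \<le> m then \<gamma> i else 0)"
      unfolding is_gamma_vector_def d using \<gamma> by simp
  next
    fix \<delta> assume \<delta>: "is_gamma_vector d h \<delta>"
    then have "h = (\<Sum>i\<le>m. smult (\<delta> i) ([:0, 1:] ^ i * [:1, 1:] ^ (2 * m - 2 * i)))"
      and 0: "\<And>i. i > m \<Longrightarrow> \<delta> i = 0"
      unfolding is_gamma_vector_def d by simp_all
    then have "\<delta> i = \<gamma> i" if "i \<le> m" for i
      using gamma_sum_inj[of \<delta> m \<gamma> i] \<gamma> that by simp
    with 0 show "\<delta> = (\<lambda>i. if i \<le> m then \<gamma> i else 0)" by (auto simp: fun_eq_iff)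
  qed
qed

lemma is_gamma_vector_gamma_vector:
  "even d \<Longrightarrow> reciprocal_poly d h \<Longrightarrow> is_gamma_vector d h (gamma_vector d h)"
  unfolding gamma_vector_def by (rule theI'[OF ex1_gamma_vector])

end

(*
  Substitute u = t + 1/t.  Since 2 T_j((t + 1/t)/2) = t^j + t^(-j), reciprocity of h gives
  t^(d/2) g(t + 1/t) = h(t).  Since t (u + 2) = (1 + t)^2, the gamma expansion gives
  h(t) = t^(d/2) P(t + 1/t) for the polynomial P(u) = (u + 2)^(d/2) gamma(1/(u + 2)).
  The field need not be algebraically closed, so not every u has the form t + 1/t; but g and P
  are polynomials agreeing at the infinitely many points n + 1/n, and hence they are equal.
*)
theory Submission imports Defs
begin

text \<open>Both sides satisfy \<open>a (n + 2) = (t + 1 / t) * a (n + 1) - a n\<close> with the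
  same values at \<open>0\<close> and \<open>1\<close>. No cosine is involved, so this works in any
  field of characteristic zero.\<close>

lemma poly_cheb_T_joukowski:
  fixes t :: "'a::field_char_0"
  assumes "t \<noteq> 0"
  shows "2 * poly (cheb_T j) ((t + 1 / t) / 2) = t ^ j + 1 / t ^ j"
proof (induction j rule: cheb_T.induct)
  case (3 n)
  have "2 * poly (cheb_T (Suc (Suc n))) ((t + 1 / t) / 2) =
        (t + 1 / t) * (2 * poly (cheb_T (Suc n)) ((t + 1 / t) / 2))
        - 2 * poly (cheb_T n) ((t + 1 / t) / 2)"
    by (simp add: algebra_simps)
  also have "\<dots> = t ^ Suc (Suc n) + 1 / t ^ Suc (Suc n)"
    unfolding 3 using assms by (simp add: field_simps)
  finally show ?case .
qed auto

text \<open>Groups the indices in pairs symmetric about the middle index \<open>m\<close>, the form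
  in which reciprocity can be applied. The induction splits off both end terms; the remaining terms
  are the case \<open>m\<close> for the shifted sequence, whose centre is
  \<open>Suc m\<close>.\<close>

lemma sum_atMost_double:
  fixes f :: "nat \<Rightarrow> 'a::comm_monoid_add"
  shows "(\<Sum>k\<le>2 * m. f k) = f m + (\<Sum>j=1..m. f (m - j) + f (m + j))"
proof (induction m arbitrary: f)
  case (Suc m)
  have "(\<Sum>k\<le>2 * Suc m. f k) = f 0 + (\<Sum>k\<le>2 * m. f (Suc k)) + f (2 * Suc m)"
    using sum.atMost_Suc[of f "Suc (2 * m)"] sum.atMost_Suc_shift[of f "2 * m"] by simp
  also have "\<dots> = f (Suc m) + (\<Sum>j=1..m. f (Suc m - j) + f (Suc m + j)) + (f 0 + f (2 * Suc m))"
    unfolding Suc by (simp add: Suc_diff_le ac_simps)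
  also have "\<dots> = f (Suc m) + (\<Sum>j=1..Suc m. f (Suc m - j) + f (Suc m + j))"
    by (simp add: mult_2 add.assoc)
  finally show ?case .
qed simp

lemma cheb_g_joukowski:
  fixes h :: "'a::field_char_0 poly"
  assumes h: "reciprocal_poly (2 * m) h" and t: "t \<noteq> 0"
  shows "t ^ m * cheb_g (2 * m) h (t + 1 / t) = poly h t"
proof -
  have "t ^ m * (coeff h (m - j) * (2 * poly (cheb_T j) ((t + 1 / t) / 2))) =
      coeff h (m - j) * t ^ (m - j) + coeff h (m + j) * t ^ (m + j)" if "j \<le> m" for j
  proof -
    have "m - j \<le> 2 * m" "2 * m - (m - j) = m + j" using that by auto
    then have c: "coeff h (m + j) = coeff h (m - j)"
      using h unfolding reciprocal_poly_def by metis
    have "t ^ m * (1 / t ^ j) = t ^ (m - j)"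
      using t that by (simp add: power_diff)
    then show ?thesis
      unfolding c poly_cheb_T_joukowski[OF t]
      by (simp add: power_add algebra_simps del: times_divide_eq_right)
  qed
  then have "t ^ m * cheb_g (2 * m) h (t + 1 / t) = coeff h m * t ^ m +
      (\<Sum>j=1..m. coeff h (m - j) * t ^ (m - j) + coeff h (m + j) * t ^ (m + j))"
    unfolding cheb_g_def by (simp add: distrib_left sum_distrib_left mult.left_commute)
  also have "\<dots> = (\<Sum>k\<le>2 * m. coeff h k * t ^ k)"
    by (rule sum_atMost_double[symmetric])
  also have "\<dots> = poly h t"
    \<comment> \<open>The true degree of \<open>h\<close> may be smaller than \<open>2 * m\<close>;
      the additional coefficients vanish.\<close>
    using h unfolding reciprocal_poly_def poly_altdef
    by (intro sum.mono_neutral_right) (auto simp: coeff_eq_0)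
  finally show ?thesis .
qed

text \<open>The sum is the polynomial P of the overview at \<open>t + 1 / t\<close>, with
  \<open>(u + 2) ^ m\<close> already distributed over the terms. Being free of division by
  \<open>u + 2\<close>, it also makes sense at \<open>u = -2\<close>, that is at
  \<open>t = -1\<close>.\<close>

lemma gamma_vector_joukowski:
  fixes h :: "'a::field_char_0 poly"
  assumes h: "reciprocal_poly (2 * m) h" and t: "t \<noteq> 0"
  shows "t ^ m * (\<Sum>i\<le>m. gamma_vector (2 * m) h i * (t + 1 / t + 2) ^ (m - i)) = poly h t"
proof -
  have sq: "t * (t + 1 / t + 2) = (1 + t) ^ 2"
    using t by (simp add: field_simps power2_eq_square)
  have "t ^ m * (t + 1 / t + 2) ^ (m - i) = t ^ i * (1 + t) ^ (2 * m - 2 * i)" if "i \<le> m" for i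
  proof -
    \<comment> \<open>Split \<open>t ^ m\<close> as \<open>t ^ i * t ^ (m - i)\<close> and absorb
      the second factor into the power, so that \<open>sq\<close> applies.\<close>
    have "t ^ m * (t + 1 / t + 2) ^ (m - i) = t ^ i * (t * (t + 1 / t + 2)) ^ (m - i)"
      unfolding power_mult_distrib mult.assoc[symmetric] power_add[symmetric] using that by simp
    then show ?thesis
      unfolding sq by (simp only: power_mult[symmetric] right_diff_distrib')
  qed
  then have "t ^ m * (\<Sum>i\<le>m. gamma_vector (2 * m) h i * (t + 1 / t + 2) ^ (m - i)) =
      (\<Sum>i\<le>m. gamma_vector (2 * m) h i * (t ^ i * (1 + t) ^ (2 * m - 2 * i)))"
    unfolding sum_distrib_left by (intro sum.cong refl) (simp add: mult.left_commute)
  also have "\<dots> = poly (\<Sum>i\<le>m. smult (gamma_vector (2 * m) h i)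
      ([:0, 1:] ^ i * [:1, 1:] ^ (2 * m - 2 * i))) t"
    by (simp add: poly_sum)
  also have "\<dots> = poly h t"
    using is_gamma_vector_gamma_vector[OF _ h] by (simp add: is_gamma_vector_def)
  finally show ?thesis .
qed

lemma infinite_joukowski_values:
  "infinite ((\<lambda>t. t + 1 / t) ` (- {0 :: 'a::field_char_0}))"
proof -
  have "inj (\<lambda>n. of_nat (Suc n) + 1 / of_nat (Suc n) :: 'a)"
  proof (rule injI)
    fix a b :: nat
    let ?x = "of_nat (Suc a) :: 'a" and ?y = "of_nat (Suc b) :: 'a"
    assume eq: "?x + 1 / ?x = ?y + 1 / ?y"
    have "?x \<noteq> 0" "?y \<noteq> 0" by (simp_all only: of_nat_eq_0_iff)
    with eq have "(?x - ?y) * (?x * ?y - 1) = 0"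
      by (simp add: field_simps del: of_nat_Suc)
    \<comment> \<open>Characteristic zero carries both alternatives back to natural numbers. A
      product of positive integers equal to \<open>1\<close> has both factors \<open>1\<close>, so
      the second alternative also gives \<open>a = b\<close>.\<close>
    then have "Suc a = Suc b \<or> of_nat (Suc a * Suc b) = (of_nat 1 :: 'a)"
      by (simp only: mult_eq_0_iff right_minus_eq of_nat_eq_iff of_nat_mult of_nat_1)
    then show "a = b"
      unfolding of_nat_eq_iff by auto
  qed
  then have "infinite (range (\<lambda>n. of_nat (Suc n) + 1 / of_nat (Suc n) :: 'a))"
    by (rule range_inj_infinite)
  moreover have "range (\<lambda>n. of_nat (Suc n) + 1 / of_nat (Suc n) :: 'a) \<subseteq> (\<lambda>t. t + 1 / t) ` (- {0})"
    by (intro image_subsetI image_eqI[OF refl]) (simp only: Compl_iff singleton_iff of_nat_eq_0_iff)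
  ultimately show ?thesis using infinite_super by blast
qed

lemma poly_eq_on_infinite:
  fixes p q :: "'a::idom poly"
  assumes "infinite S" "\<And>x. x \<in> S \<Longrightarrow> poly p x = poly q x"
  shows "p = q"
proof (rule ccontr)
  assume "p \<noteq> q"
  then have "finite {x. poly (p - q) x = 0}" by (intro poly_roots_finite) simp
  moreover have "S \<subseteq> {x. poly (p - q) x = 0}" using assms(2) by auto
  ultimately show False using assms(1) finite_subset by blast
qed

lemma cheb_g_eq_gamma_sum:
  fixes h :: "'a::field_char_0 poly"
  assumes h: "reciprocal_poly (2 * m) h"
  shows "cheb_g (2 * m) h u = (\<Sum>i\<le>m. gamma_vector (2 * m) h i * (u + 2) ^ (m - i))"
proof -
  \<comment> \<open>\<open>cheb_g\<close> is only a function, so both sides are first realized as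
    polynomials; agreement on an infinite set then extends to every \<open>u\<close>.\<close>
  define P where "P = (\<Sum>i\<le>m. smult (gamma_vector (2 * m) h i) ([:2, 1:] ^ (m - i)))"
  define Q where "Q = [:coeff h m:] +
    smult 2 (\<Sum>j=1..m. smult (coeff h (m - j)) (pcompose (cheb_T j) [:0, 1 / 2:]))"
  have P: "poly P x = (\<Sum>i\<le>m. gamma_vector (2 * m) h i * (x + 2) ^ (m - i))" for x
    by (simp add: P_def poly_sum add.commute)
  have Q: "poly Q x = cheb_g (2 * m) h x" for x
    by (simp add: Q_def cheb_g_def poly_sum poly_pcompose)
  have "Q = P"
  proof (rule poly_eq_on_infinite[OF infinite_joukowski_values])
    fix x :: 'a assume "x \<in> (\<lambda>t. t + 1 / t) ` (- {0})"
    then obtain t where t: "t \<noteq> 0" "x = t + 1 / t" by auto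
    have "t ^ m * poly Q x = t ^ m * poly P x"
      unfolding P Q t(2) cheb_g_joukowski[OF h t(1)] gamma_vector_joukowski[OF h t(1)] ..
    with t(1) show "poly Q x = poly P x" by simp
  qed
  then show ?thesis using P Q by metis
qed

theorem mainTheorem1:
  fixes d :: nat and h :: "'a::field_char_0 poly"
  assumes "even d" and "reciprocal_poly d h"
  shows "(\<forall>u. u \<noteq> 0 \<longrightarrow>
            poly (gamma_poly d h) u = u ^ (d div 2) * cheb_g d h (1 / u - 2)) \<and>
         (\<forall>u. u \<noteq> 0 \<longrightarrow>
            u ^ (d div 2) * poly (gamma_poly d h) (1 / u) = cheb_g d h (u - 2)) \<and>
         (\<forall>u. u + 2 \<noteq> 0 \<longrightarrow>
            (u + 2) ^ (d div 2) * poly (gamma_poly d h) (1 / (u + 2)) = cheb_g d h u)"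
proof -
  obtain m where d: "d = 2 * m" using assms(1) by blast
  \<comment> \<open>The second of the three identities suffices: the first follows by replacing
    \<open>u\<close> by \<open>1 / u\<close>, the third by replacing \<open>u\<close> by
    \<open>u + 2\<close>.\<close>
  have key: "u ^ m * poly (gamma_poly d h) (1 / u) = cheb_g d h (u - 2)" if "u \<noteq> 0" for u
  proof -
    have "u ^ m * poly (gamma_poly d h) (1 / u) =
        (\<Sum>i\<le>m. u ^ m * (gamma_vector d h i * (1 / u) ^ i))"
      by (simp add: d gamma_poly_def poly_sum poly_monom sum_distrib_left)
    also have "\<dots> = (\<Sum>i\<le>m. gamma_vector d h i * u ^ (m - i))"
      using that by (intro sum.cong refl) (simp add: power_diff power_one_over)
    also have "\<dots> = cheb_g d h (u - 2)"
      using assms(2) by (simp add: d cheb_g_eq_gamma_sum)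
    finally show ?thesis .
  qed
  have "poly (gamma_poly d h) u = u ^ m * cheb_g d h (1 / u - 2)" if "u \<noteq> 0" for u
    using key[of "1 / u"] that by (simp add: field_simps)
  moreover have "(u + 2) ^ m * poly (gamma_poly d h) (1 / (u + 2)) = cheb_g d h u"
    if "u + 2 \<noteq> 0" for u
    using key[OF that] by simp
  ultimately show ?thesis using key d by simp
qed

end
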